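(* Let $\alpha\models n$ and let $\beta$ be a composition. Then $$\left\langle\mathbf{H}_\alpha^{qt},\mathbf{H}_\beta^{qt}\right\rangle=(-1)^{|\alpha|+\ell(\alpha)}\,\delta_{\alpha\,\beta^c}\prod_{i=1}^{n-1}(1-q^it^{n-i}),$$ where $\mathbf{H}_\alpha^{qt}=\sum_{\beta\models|\alpha|}t^{c(\alpha,\beta^c)}q^{c(\alpha',\overleftarrow{\beta})}\,\mathbf{s}_\beta$.
   Context: A composition $\alpha$ of a positive integer $n$ ($\alpha\models n$) is a sequence $(\alpha_1,\dots,\alpha_\ell)$ of positive integers with sum $n$; $|\alpha|=n$, $\ell(\alpha)=\ell$. The descent set is $D(\alpha)=\{\alpha_1,\alpha_1+\alpha_2,\dots,\alpha_1+\cdots+\alpha_{\ell-1}\}\subseteq\{1,\dots,n-1\}$; $\alpha\mapsto D(\alpha)$ is a bijection onto subsets of $\{1,\dots,n-1\}$. For compositions of the same $n$, $\alpha\le\beta$ (equivalently $\beta\ge\alpha$) means $D(\beta)\subseteq D(\alpha)$. Involutions: $\overleftarrow{\alpha}=(\alpha_\ell,\dots,\alpha_1)$; $\alpha^c$ is the composition of $n$ with $D(\alpha^c)=\{1,\dots,n-1\}\setminus D(\alpha)$; $\alpha'=\overleftarrow{\alpha^c}$. For $\alpha,\beta\models n$, $c(\alpha,\beta)=\sum_{i\in D(\alpha)\cap D(\beta)} i$. $NC\Lambda$ is the free associative algebra on $\mathbf{h}_1,\mathbf{h}_2,\dots$ over $\mathbb{Q}$, with coefficients extended to $\mathbb{Q}(q,t)$.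 Put $\mathbf{h}_\alpha=\mathbf{h}_{\alpha_1}\cdots\mathbf{h}_{\alpha_\ell}$. The ribbon Schur functions $\mathbf{s}_\alpha=\sum_{\beta\ge\alpha}(-1)^{\ell(\alpha)-\ell(\beta)}\mathbf{h}_\beta$, $\alpha\models n$, form a basis of the degree $n$ part ($\deg\mathbf{h}_k=k$). The scalar product on $NC\Lambda$ is the bilinear form with $\langle \mathbf{s}_\alpha,\mathbf{s}_\beta\rangle=(-1)^{|\alpha|+\ell(\alpha)}\delta_{\alpha\,\beta^c}$ (in particular it is $0$ if $|\alpha|\neq|\beta|$). *)

theory Defs
  imports
    "HOL-Library.Poly_Mapping"
    "HOL-Computational_Algebra.Polynomial"
    "HOL-Computational_Algebra.Fraction_Field"
begin

section \<open>Compositions\<close>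

text \<open>The type also contains the empty list: it is the empty word of the free monoid below, and
  as an index it stands for the degree 0 part. ``\<open>\<alpha>\<close> is a composition of the positive integer
  \<open>n\<close>'' is the predicate \<open>\<alpha> \<Turnstile> n\<close>, which excludes it.\<close>

typedef composition = "{xs :: nat list. 0 \<notin> set xs}"
  morphisms parts Composition
  by (rule exI[of _ "[]"]) simp

setup_lifting type_definition_composition

instantiation composition :: monoid_add
begin

lift_definition zero_composition :: composition is "[]" by simp

lift_definition plus_composition :: "composition \<Rightarrow> composition \<Rightarrow> composition" is "(@)" by auto

instance by standard (transfer, simp)+

end

definition weight :: "composition \<Rightarrow> nat" where
  "weight \<alpha> = sum_list (parts \<alpha>)"

definition len :: "composition \<Rightarrow> nat" where
  "len \<alpha> = length (parts \<alpha>)"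

definition composition_of :: "composition \<Rightarrow> nat \<Rightarrow> bool" (infix "\<Turnstile>" 50) where
  "\<alpha> \<Turnstile> n \<longleftrightarrow> 0 < n \<and> weight \<alpha> = n"

definition partial_sums :: "nat list \<Rightarrow> nat set" where
  "partial_sums xs = (\<lambda>i. sum_list (take i xs)) ` {1..<length xs}"

definition descents :: "composition \<Rightarrow> nat set" where
  "descents \<alpha> = partial_sums (parts \<alpha>)"

text \<open>The larger composition is the coarser one.\<close>

definition comp_le :: "composition \<Rightarrow> composition \<Rightarrow> bool" (infix "\<preceq>" 50) where
  "\<alpha> \<preceq> \<beta> \<longleftrightarrow> weight \<alpha> = weight \<beta> \<and> descents \<beta> \<subseteq> descents \<alpha>"

lift_definition rev_comp :: "composition \<Rightarrow> composition" is rev by simp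

text \<open>Existence and uniqueness are proved in \<open>bij_descents\<close> below.\<close>

definition compl_comp :: "composition \<Rightarrow> composition" where
  "compl_comp \<alpha> =
    (THE \<gamma>. weight \<gamma> = weight \<alpha> \<and> descents \<gamma> = {1..<weight \<alpha>} - descents \<alpha>)"

definition conj_comp :: "composition \<Rightarrow> composition" where
  "conj_comp \<alpha> = rev_comp (compl_comp \<alpha>)"

definition c_stat :: "composition \<Rightarrow> composition \<Rightarrow> nat" where
  "c_stat \<alpha> \<beta> = \<Sum>(descents \<alpha> \<inter> descents \<beta>)"

lemma partial_sums_snoc:
  "partial_sums (xs @ [k]) = (if xs = [] then {} else insert (sum_list xs) (partial_sums xs))"
proof (cases "xs = []")
  case False
  then have "{1..<length (xs @ [k])} = insert (length xs) {1..<length xs}"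
    by (cases xs) auto
  then show ?thesis
    using False by (auto simp: partial_sums_def)
qed (auto simp: partial_sums_def)

lemma partial_sums_bounds:
  "0 \<notin> set xs \<Longrightarrow> partial_sums xs \<subseteq> {1..<sum_list xs}"
proof (induction xs rule: rev_induct)
  case Nil
  then show ?case by (simp add: partial_sums_def)
next
  case (snoc k xs)
  then have "xs \<noteq> [] \<Longrightarrow> 1 \<le> sum_list xs"
    by (cases xs) auto
  moreover have "\<forall>x\<in>partial_sums xs. 1 \<le> x \<and> x < sum_list xs" "0 < k"
    using snoc by auto
  ultimately have "\<And>x. x \<in> partial_sums (xs @ [k]) \<Longrightarrow> 1 \<le> x \<and> x < sum_list xs + k"
    unfolding partial_sums_snoc by (metis add.commute empty_iff insertE less_add_same_cancel2 trans_less_add1)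
  then show ?case
    by auto
qed

lemma partial_sums_card:
  "0 \<notin> set xs \<Longrightarrow> card (partial_sums xs) = length xs - 1"
proof (induction xs rule: rev_induct)
  case Nil
  then show ?case by (simp add: partial_sums_def)
next
  case (snoc k xs)
  then have "sum_list xs \<notin> partial_sums xs"
    using partial_sums_bounds[of xs] by auto
  moreover have "finite (partial_sums xs)"
    by (simp add: partial_sums_def)
  moreover have "xs \<noteq> [] \<Longrightarrow> 0 < length xs"
    by simp
  ultimately show ?case
    using snoc by (auto simp: partial_sums_snoc)
qed

lemma partial_sums_inj:
  assumes "0 \<notin> set xs" "0 \<notin> set ys" "sum_list xs = sum_list ys" "partial_sums xs = partial_sums ys"
  shows "xs = ys"
  using assms
proof (induction xs arbitrary: ys rule: rev_induct)
  case Nil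
  then show ?case by (cases ys) auto
next
  case (snoc k xs)
  from snoc.prems obtain l zs where ys: "ys = zs @ [l]"
    by (cases ys rule: rev_cases) auto
  have b: "\<And>x. x \<in> partial_sums xs \<Longrightarrow> x < sum_list xs" "\<And>x. x \<in> partial_sums zs \<Longrightarrow> x < sum_list zs"
    using partial_sums_bounds[of xs] partial_sums_bounds[of zs] snoc.prems ys by auto
  have e: "(if xs = [] then {} else insert (sum_list xs) (partial_sums xs)) =
     (if zs = [] then {} else insert (sum_list zs) (partial_sums zs))"
    using snoc.prems ys by (simp only: partial_sums_snoc)
  show ?case
  proof (cases "xs = []")
    case True
    then show ?thesis using e ys snoc.prems by (auto split: if_splits)
  next
    case False
    then have "zs \<noteq> []" using e by auto
    with False e have e': "insert (sum_list xs) (partial_sums xs) = insert (sum_list zs) (partial_sums zs)"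
      by simp
    have s: "sum_list xs = sum_list zs"
    proof (rule antisym)
      show "sum_list xs \<le> sum_list zs" using e' b(2) by (metis insert_iff less_imp_le order_refl)
      show "sum_list zs \<le> sum_list xs" using e' b(1) by (metis insert_iff less_imp_le order_refl)
    qed
    have "partial_sums xs = partial_sums zs"
      using e' s b by (metis insert_ident less_irrefl)
    with s snoc.IH[of zs] snoc.prems ys have "xs = zs" by simp
    then show ?thesis using ys snoc.prems by simp
  qed
qed

lemma partial_sums_surj:
  "S \<subseteq> {1..<n} \<Longrightarrow> \<exists>xs. 0 \<notin> set xs \<and> sum_list xs = n \<and> partial_sums xs = S"
proof (induction n arbitrary: S rule: less_induct)
  case (less n)
  show ?case
  proof (cases "S = {}")
    case True
    show ?thesis
    proof (cases "n = 0")
      case True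
      then show ?thesis
        using \<open>S = {}\<close> by (intro exI[of _ "[]"]) (simp add: partial_sums_def)
    next
      case False
      then show ?thesis
        using \<open>S = {}\<close> by (intro exI[of _ "[n]"]) (simp add: partial_sums_def)
    qed
  next
    case False
    define m where "m = Max S"
    have fin: "finite S" using finite_subset[OF less.prems] by simp
    then have m: "m \<in> S" "\<And>x. x \<in> S \<Longrightarrow> x \<le> m" using False by (simp_all add: m_def)
    have mn: "1 \<le> m" "m < n" using subsetD[OF less.prems m(1)] by simp_all
    have "S - {m} \<subseteq> {1..<m}"
    proof
      fix x assume x: "x \<in> S - {m}"
      then have "x \<le> m" "x \<noteq> m" "1 \<le> x" using m(2)[of x] subsetD[OF less.prems, of x] by simp_all
      then show "x \<in> {1..<m}" by simp
    qed
    from less.IH[OF mn(2) this] obtain xs where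
      xs: "0 \<notin> set xs" "sum_list xs = m" "partial_sums xs = S - {m}" by blast
    have "xs \<noteq> []" using xs(2) mn(1) by (cases xs) simp_all
    then show ?thesis
      using xs mn m(1) by (intro exI[of _ "xs @ [n - m]"]) (simp add: partial_sums_snoc insert_absorb)
  qed
qed

lemma bij_descents: "bij_betw descents {\<alpha>. weight \<alpha> = n} (Pow {1..<n})"
proof (rule bij_betwI')
  fix \<alpha> \<beta> assume "\<alpha> \<in> {\<alpha>. weight \<alpha> = n}" "\<beta> \<in> {\<alpha>. weight \<alpha> = n}"
  then show "(descents \<alpha> = descents \<beta>) = (\<alpha> = \<beta>)"
    using partial_sums_inj[of "parts \<alpha>" "parts \<beta>"] parts[of \<alpha>] parts[of \<beta>]
    by (auto simp: descents_def weight_def parts_inject)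
next
  fix \<alpha> assume "\<alpha> \<in> {\<alpha>. weight \<alpha> = n}"
  then show "descents \<alpha> \<in> Pow {1..<n}"
    using partial_sums_bounds[of "parts \<alpha>"] parts[of \<alpha>] by (auto simp: descents_def weight_def)
next
  fix S assume "S \<in> Pow {1..<n}"
  then obtain xs where "0 \<notin> set xs" "sum_list xs = n" "partial_sums xs = S"
    using partial_sums_surj by blast
  then show "\<exists>\<alpha>\<in>{\<alpha>. weight \<alpha> = n}. S = descents \<alpha>"
    by (intro bexI[of _ "Composition xs"]) (auto simp: descents_def weight_def Composition_inverse)
qed

lemma compl_comp:
  "weight (compl_comp \<alpha>) = weight \<alpha>"
  "descents (compl_comp \<alpha>) = {1..<weight \<alpha>} - descents \<alpha>"
proof -
  have "{1..<weight \<alpha>} - descents \<alpha> \<in> descents ` {\<gamma>. weight \<gamma> = weight \<alpha>}"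
    using bij_betw_imp_surj_on[OF bij_descents[of "weight \<alpha>"]] by auto
  moreover have "inj_on descents {\<gamma>. weight \<gamma> = weight \<alpha>}"
    by (rule bij_betw_imp_inj_on[OF bij_descents])
  ultimately have "\<exists>!\<gamma>. weight \<gamma> = weight \<alpha> \<and> descents \<gamma> = {1..<weight \<alpha>} - descents \<alpha>"
    by (auto simp: inj_on_def)
  from theI'[OF this] show
    "weight (compl_comp \<alpha>) = weight \<alpha>"
    "descents (compl_comp \<alpha>) = {1..<weight \<alpha>} - descents \<alpha>"
    by (simp_all add: compl_comp_def)
qed

lemma finite_weight [simp]: "finite {\<alpha>. weight \<alpha> = n}"
  using bij_betw_finite[OF bij_descents[of n]] by simp

lemma finite_coarser [simp]: "finite {\<beta>. \<alpha> \<preceq> \<beta>}"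
  by (rule finite_subset[OF _ finite_weight[of "weight \<alpha>"]]) (auto simp: comp_le_def)

lemma finite_descents [simp]: "finite (descents \<alpha>)"
  by (simp add: descents_def partial_sums_def)

lemma len_diff:
  assumes "\<alpha> \<preceq> \<beta>"
  shows "len \<alpha> - len \<beta> = card (descents \<alpha>) - card (descents \<beta>)"
proof -
  have z: "weight \<gamma> = 0 \<longleftrightarrow> len \<gamma> = 0" for \<gamma>
  proof -
    from parts[of \<gamma>] have "0 \<notin> set (parts \<gamma>)" by simp
    then show ?thesis by (cases "parts \<gamma>") (auto simp: weight_def len_def)
  qed
  have "card (descents \<gamma>) = len \<gamma> - 1" for \<gamma>
    using partial_sums_card parts[of \<gamma>] by (simp add: descents_def len_def)
  then show ?thesis
    using assms z[of \<alpha>] z[of \<beta>] by (auto simp: comp_le_def)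
qed

lemma bij_coarser: "bij_betw descents {\<beta>. \<alpha> \<preceq> \<beta>} (Pow (descents \<alpha>))"
proof -
  have D: "descents \<alpha> \<subseteq> {1..<weight \<alpha>}"
    using bij_betw_apply[OF bij_descents, of \<alpha> "weight \<alpha>"] by auto
  have "descents ` {\<beta>. \<alpha> \<preceq> \<beta>} = Pow (descents \<alpha>)"
  proof
    show "descents ` {\<beta>. \<alpha> \<preceq> \<beta>} \<subseteq> Pow (descents \<alpha>)"
      by (auto simp: comp_le_def)
    show "Pow (descents \<alpha>) \<subseteq> descents ` {\<beta>. \<alpha> \<preceq> \<beta>}"
    proof
      fix S assume S: "S \<in> Pow (descents \<alpha>)"
      then have "S \<in> descents ` {\<beta>. weight \<beta> = weight \<alpha>}"
        unfolding bij_betw_imp_surj_on[OF bij_descents] using D by blast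
      then obtain \<beta> where "weight \<beta> = weight \<alpha>" "S = descents \<beta>"
        by blast
      with S show "S \<in> descents ` {\<beta>. \<alpha> \<preceq> \<beta>}"
        by (auto simp: comp_le_def)
    qed
  qed
  then show ?thesis
    by (rule bij_betw_subset[OF bij_descents[of "weight \<alpha>"], rotated])
      (auto simp: comp_le_def)
qed

section \<open>Noncommutative symmetric functions over \<open>\<rat>(q,t)\<close>\<close>

text \<open>\<open>\<rat>(q,t)\<close> as the fraction field of \<open>\<rat>[q][t]\<close>.\<close>

type_synonym qt_field = "rat poly poly fract"

definition q_var :: qt_field where "q_var = Fract [:[:0, 1:]:] 1"

definition t_var :: qt_field where "t_var = Fract [:0, 1:] 1"

text \<open>The free associative algebra on generators indexed by the positive integers is the monoid
  algebra of the free monoid on these integers: finitely supported functions on words, where the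
  library product is the convolution along \<open>+\<close> (here concatenation of words).\<close>

type_synonym ncsym = "composition \<Rightarrow>\<^sub>0 qt_field"

definition scale :: "qt_field \<Rightarrow> ncsym \<Rightarrow> ncsym" (infixr "*\<^sub>K" 75) where
  "c *\<^sub>K x = Poly_Mapping.map ((*) c) x"

text \<open>Only meant for \<open>k > 0\<close>.\<close>

definition gen_h :: "nat \<Rightarrow> ncsym" where
  "gen_h k = Poly_Mapping.single (Composition [k]) 1"

definition h_comp :: "composition \<Rightarrow> ncsym" where
  "h_comp \<alpha> = prod_list (map gen_h (parts \<alpha>))"

text \<open>The subtraction does not truncate, as a coarser composition has at most as many parts.\<close>

definition ribbon :: "composition \<Rightarrow> ncsym" where
  "ribbon \<alpha> = (\<Sum>\<beta> | \<alpha> \<preceq> \<beta>. (-1) ^ (len \<alpha> - len \<beta>) *\<^sub>K h_comp \<beta>)"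

definition bilinear_form :: "(ncsym \<Rightarrow> ncsym \<Rightarrow> qt_field) \<Rightarrow> bool" where
  "bilinear_form B \<longleftrightarrow>
    (\<forall>x. Vector_Spaces.linear (*\<^sub>K) (*) (\<lambda>y. B x y)) \<and>
    (\<forall>y. Vector_Spaces.linear (*\<^sub>K) (*) (\<lambda>x. B x y))"

definition ribbon_form :: "composition \<Rightarrow> composition \<Rightarrow> qt_field" where
  "ribbon_form \<alpha> \<beta> = (-1) ^ (weight \<alpha> + len \<alpha>) * (if \<alpha> = compl_comp \<beta> then 1 else 0)"

text \<open>Existence and uniqueness are proved in \<open>ex1_scalar_product\<close> below.\<close>

definition scalar_product :: "ncsym \<Rightarrow> ncsym \<Rightarrow> qt_field" where
  "scalar_product =
    (THE B. bilinear_form B \<and> (\<forall>\<alpha> \<beta>. B (ribbon \<alpha>) (ribbon \<beta>) = ribbon_form \<alpha> \<beta>))"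

definition H_qt :: "composition \<Rightarrow> ncsym" where
  "H_qt \<alpha> =
    (\<Sum>\<beta> | weight \<beta> = weight \<alpha>.
      (t_var ^ c_stat \<alpha> (compl_comp \<beta>) * q_var ^ c_stat (conj_comp \<alpha>) (rev_comp \<beta>)) *\<^sub>K ribbon \<beta>)"

lemma lookup_scale [simp]:
  "Poly_Mapping.lookup (c *\<^sub>K x) \<alpha> = c * Poly_Mapping.lookup x \<alpha>"
  by (simp add: scale_def Poly_Mapping.map.rep_eq when_def)

lemma vector_space_scale: "vector_space (*\<^sub>K)"
  by standard (auto intro!: poly_mapping_eqI simp: lookup_add algebra_simps)

lemma vector_space_mult: "vector_space ((*) :: qt_field \<Rightarrow> qt_field \<Rightarrow> qt_field)"
  by standard (auto simp: algebra_simps)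

lemma h_comp_eq_single: "h_comp \<alpha> = Poly_Mapping.single \<alpha> 1"
proof -
  have "prod_list (map gen_h xs) = Poly_Mapping.single (Composition xs) 1" if "0 \<notin> set xs" for xs
    using that
  proof (induction xs)
    case Nil
    then show ?case by (simp flip: zero_composition_def)
  next
    case (Cons k xs)
    then have "Composition [k] + Composition xs = Composition (k # xs)"
      by (simp add: plus_composition_def Composition_inverse)
    with Cons show ?case by (simp add: gen_h_def mult_single)
  qed
  from this[of "parts \<alpha>"] parts[of \<alpha>] show ?thesis
    by (simp add: h_comp_def parts_inverse)
qed

lemma sum_coarser:
  "(\<Sum>\<beta> | \<alpha> \<preceq> \<beta>. F (descents \<beta>)) = (\<Sum>T\<in>Pow (descents \<alpha>). F T)"
  by (rule sum.reindex_bij_betw[OF bij_coarser])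

lemma coarser_inversion:
  fixes f :: "composition \<Rightarrow> 'a::ring_1"
  obtains f' where
    "\<forall>\<beta>. weight \<beta> = n \<longrightarrow> f' (descents \<beta>) = f \<beta>"
    "\<forall>\<beta>. weight \<beta> = n \<longrightarrow> (\<Sum>\<gamma> | \<beta> \<preceq> \<gamma>. f \<gamma>) = sum f' (Pow (descents \<beta>))"
    "\<forall>\<beta>. weight \<beta> = n \<longrightarrow> (\<Sum>\<gamma> | \<beta> \<preceq> \<gamma>. (-1) ^ (len \<beta> - len \<gamma>) * f \<gamma>) =
       (\<Sum>T\<in>Pow (descents \<beta>). (-1) ^ (card (descents \<beta>) - card T) * f' T)"
proof -
  define f' where "f' = (\<lambda>T. f (the_inv_into {\<beta>. weight \<beta> = n} descents T))"
  have 1: "f' (descents \<beta>) = f \<beta>" if "weight \<beta> = n" for \<beta>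
    using the_inv_into_f_f[OF bij_betw_imp_inj_on[OF bij_descents[of n]], of \<beta>] that
    by (simp add: f'_def)
  have 2: "f \<gamma> = f' (descents \<gamma>)" if "weight \<beta> = n" "\<beta> \<preceq> \<gamma>" for \<beta> \<gamma>
    using 1[of \<gamma>] that by (simp add: comp_le_def)
  show ?thesis
  proof (rule that[of f']; intro allI impI)
    fix \<beta> assume w: "weight \<beta> = n"
    show "(\<Sum>\<gamma> | \<beta> \<preceq> \<gamma>. f \<gamma>) = sum f' (Pow (descents \<beta>))"
      unfolding sum_coarser[symmetric] by (rule sum.cong) (simp_all add: 2[OF w])
    show "(\<Sum>\<gamma> | \<beta> \<preceq> \<gamma>. (-1) ^ (len \<beta> - len \<gamma>) * f \<gamma>) =
       (\<Sum>T\<in>Pow (descents \<beta>). (-1) ^ (card (descents \<beta>) - card T) * f' T)"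
      unfolding sum_coarser[symmetric] by (rule sum.cong) (simp_all add: 2[OF w] len_diff)
  qed (rule 1)
qed

lemma coarser_mobius:
  fixes f g :: "composition \<Rightarrow> 'a::ring_1"
  assumes g: "\<And>\<beta>. g \<beta> = (\<Sum>\<gamma> | \<beta> \<preceq> \<gamma>. f \<gamma>)"
  shows "(\<Sum>\<beta> | \<alpha> \<preceq> \<beta>. (-1) ^ (len \<alpha> - len \<beta>) * g \<beta>) = f \<alpha>"
proof -
  obtain f' where f':
    "\<forall>\<beta>. weight \<beta> = weight \<alpha> \<longrightarrow> f' (descents \<beta>) = f \<beta>"
    "\<forall>\<beta>. weight \<beta> = weight \<alpha> \<longrightarrow> (\<Sum>\<gamma> | \<beta> \<preceq> \<gamma>. f \<gamma>) = sum f' (Pow (descents \<beta>))"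
    "\<forall>\<beta>. weight \<beta> = weight \<alpha> \<longrightarrow> (\<Sum>\<gamma> | \<beta> \<preceq> \<gamma>. (-1) ^ (len \<beta> - len \<gamma>) * f \<gamma>) =
       (\<Sum>T\<in>Pow (descents \<beta>). (-1) ^ (card (descents \<beta>) - card T) * f' T)"
    by (rule coarser_inversion[where f = f and n = "weight \<alpha>"])
  have "(\<Sum>\<beta> | \<alpha> \<preceq> \<beta>. (-1) ^ (len \<alpha> - len \<beta>) * g \<beta>) =
    (\<Sum>\<beta> | \<alpha> \<preceq> \<beta>. (-1) ^ (card (descents \<alpha>) - card (descents \<beta>)) * sum f' (Pow (descents \<beta>)))"
  proof (rule sum.cong[OF refl])
    fix \<beta> assume "\<beta> \<in> {\<beta>. \<alpha> \<preceq> \<beta>}"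
    then have le: "\<alpha> \<preceq> \<beta>" and w: "weight \<beta> = weight \<alpha>" by (simp_all add: comp_le_def)
    show "(-1) ^ (len \<alpha> - len \<beta>) * g \<beta> =
        (-1) ^ (card (descents \<alpha>) - card (descents \<beta>)) * sum f' (Pow (descents \<beta>))"
      by (simp only: g f'(2)[rule_format, OF w] len_diff[OF le])
  qed
  also have "\<dots> = (\<Sum>T\<in>Pow (descents \<alpha>). (-1) ^ (card (descents \<alpha>) - card T) * sum f' (Pow T))"
    by (rule sum_coarser)
  also have "\<dots> = f' (descents \<alpha>)"
    by (rule inclusion_exclusion_mobius[symmetric]) simp_all
  finally show ?thesis by (simp add: f'(1))
qed

lemma coarser_mobius':
  fixes f g :: "composition \<Rightarrow> 'a::ring_1"
  assumes g: "\<And>\<beta>. g \<beta> = (\<Sum>\<gamma> | \<beta> \<preceq> \<gamma>. (-1) ^ (len \<beta> - len \<gamma>) * f \<gamma>)"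
  shows "(\<Sum>\<beta> | \<alpha> \<preceq> \<beta>. g \<beta>) = f \<alpha>"
proof -
  obtain f' where f':
    "\<forall>\<beta>. weight \<beta> = weight \<alpha> \<longrightarrow> f' (descents \<beta>) = f \<beta>"
    "\<forall>\<beta>. weight \<beta> = weight \<alpha> \<longrightarrow> (\<Sum>\<gamma> | \<beta> \<preceq> \<gamma>. f \<gamma>) = sum f' (Pow (descents \<beta>))"
    "\<forall>\<beta>. weight \<beta> = weight \<alpha> \<longrightarrow> (\<Sum>\<gamma> | \<beta> \<preceq> \<gamma>. (-1) ^ (len \<beta> - len \<gamma>) * f \<gamma>) =
       (\<Sum>T\<in>Pow (descents \<beta>). (-1) ^ (card (descents \<beta>) - card T) * f' T)"
    by (rule coarser_inversion[where f = f and n = "weight \<alpha>"])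
  define g' where "g' S = (\<Sum>T\<in>Pow S. (-1) ^ card T * f' T)" for S
  have g': "(\<Sum>T\<in>Pow S. (-1) ^ (card S - card T) * f' T) = (-1) ^ card S * g' S"
    if "finite S" for S
    unfolding g'_def sum_distrib_left mult.assoc[symmetric] power_add[symmetric]
    using that by (intro sum.cong refl)
      (simp add: card_mono neg_one_power_add_eq_neg_one_power_diff)
  have "(\<Sum>\<beta> | \<alpha> \<preceq> \<beta>. g \<beta>) = (\<Sum>\<beta> | \<alpha> \<preceq> \<beta>. (-1) ^ card (descents \<beta>) * g' (descents \<beta>))"
  proof (rule sum.cong[OF refl])
    fix \<beta> assume "\<beta> \<in> {\<beta>. \<alpha> \<preceq> \<beta>}"
    then have w: "weight \<beta> = weight \<alpha>" by (simp add: comp_le_def)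
    show "g \<beta> = (-1) ^ card (descents \<beta>) * g' (descents \<beta>)"
      by (simp only: g f'(3)[rule_format, OF w] g'[OF finite_descents])
  qed
  also have "\<dots> = (\<Sum>T\<in>Pow (descents \<alpha>). (-1) ^ card T * g' T)"
    by (rule sum_coarser)
  also have "\<dots> = f' (descents \<alpha>)"
    by (rule inclusion_exclusion_symmetric[symmetric]) (simp_all add: g'_def)
  finally show ?thesis by (simp add: f'(1))
qed

lemma scale_sign: "(-1) ^ k *\<^sub>K x = (-1) ^ k * x"
proof (induction k)
  case 0
  then show ?case by (auto intro!: poly_mapping_eqI)
next
  case (Suc k)
  have "(-1) ^ Suc k *\<^sub>K x = - ((-1) ^ k *\<^sub>K x)"
    by (auto intro!: poly_mapping_eqI)
  with Suc show ?case by simp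
qed

lemma h_comp_eq_sum_ribbon: "h_comp \<alpha> = (\<Sum>\<beta> | \<alpha> \<preceq> \<beta>. ribbon \<beta>)"
  by (rule coarser_mobius'[symmetric]) (simp only: ribbon_def scale_sign)

lemma linear_form_sum:
  assumes "Vector_Spaces.linear (*\<^sub>K) (*) F"
  shows "F (\<Sum>x\<in>A. c x *\<^sub>K g x) = (\<Sum>x\<in>A. c x * F (g x))"
proof -
  interpret Vector_Spaces.linear "(*\<^sub>K)" "(*)" F by fact
  show ?thesis by (simp add: sum scale)
qed

lemma expand_h: "x = (\<Sum>\<alpha>\<in>Poly_Mapping.keys x. Poly_Mapping.lookup x \<alpha> *\<^sub>K h_comp \<alpha>)"
  by (rule poly_mapping_eqI)
    (simp add: lookup_sum h_comp_eq_single lookup_single when_def in_keys_iff if_distrib cong: if_cong)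

lemma linear_form_ext:
  assumes F: "Vector_Spaces.linear (*\<^sub>K) (*) F" and G: "Vector_Spaces.linear (*\<^sub>K) (*) G"
    and eq: "\<And>\<alpha>. F (ribbon \<alpha>) = G (ribbon \<alpha>)"
  shows "F x = G x"
proof -
  interpret F: Vector_Spaces.linear "(*\<^sub>K)" "(*)" F by fact
  interpret G: Vector_Spaces.linear "(*\<^sub>K)" "(*)" G by fact
  have h: "F (h_comp \<alpha>) = G (h_comp \<alpha>)" for \<alpha>
    by (simp add: h_comp_eq_sum_ribbon F.sum G.sum eq)
  have "F x = F (\<Sum>\<alpha>\<in>Poly_Mapping.keys x. Poly_Mapping.lookup x \<alpha> *\<^sub>K h_comp \<alpha>)"
    by (simp flip: expand_h)
  also have "\<dots> = G (\<Sum>\<alpha>\<in>Poly_Mapping.keys x. Poly_Mapping.lookup x \<alpha> *\<^sub>K h_comp \<alpha>)"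
    by (simp only: linear_form_sum[OF F] linear_form_sum[OF G] h)
  also have "\<dots> = G x" by (simp flip: expand_h)
  finally show ?thesis .
qed

text \<open>The linear form with prescribed values on the words.\<close>

definition extend_form :: "(composition \<Rightarrow> qt_field) \<Rightarrow> ncsym \<Rightarrow> qt_field" where
  "extend_form v x = (\<Sum>\<alpha>\<in>Poly_Mapping.keys x. Poly_Mapping.lookup x \<alpha> * v \<alpha>)"

lemma extend_form_superset:
  assumes "finite A" "Poly_Mapping.keys x \<subseteq> A"
  shows "extend_form v x = (\<Sum>\<alpha>\<in>A. Poly_Mapping.lookup x \<alpha> * v \<alpha>)"
  unfolding extend_form_def
  by (rule sum.mono_neutral_left) (use assms in \<open>auto simp: in_keys_iff\<close>)

lemma linear_extend_form: "Vector_Spaces.linear (*\<^sub>K) (*) (extend_form v)"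
  unfolding Vector_Spaces.linear_iff
proof (intro conjI allI vector_space_scale vector_space_mult)
  fix x y :: ncsym
  let ?A = "Poly_Mapping.keys x \<union> Poly_Mapping.keys y"
  show "extend_form v (x + y) = extend_form v x + extend_form v y"
    using Poly_Mapping.keys_add[of x y]
    by (simp add: extend_form_superset[of ?A] lookup_add algebra_simps sum.distrib)
next
  fix c and x :: ncsym
  have "Poly_Mapping.keys (c *\<^sub>K x) \<subseteq> Poly_Mapping.keys x"
    by (auto simp: in_keys_iff)
  then show "extend_form v (c *\<^sub>K x) = c * extend_form v x"
    by (simp add: extend_form_superset[of "Poly_Mapping.keys x"] sum_distrib_left mult.assoc)
qed

lemma extend_form_h [simp]: "extend_form v (h_comp \<alpha>) = v \<alpha>"
  by (simp add: h_comp_eq_single extend_form_def)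

lemma extend_form_ribbon:
  assumes "\<And>\<alpha>. v \<alpha> = (\<Sum>\<beta> | \<alpha> \<preceq> \<beta>. w \<beta>)"
  shows "extend_form v (ribbon \<alpha>) = w \<alpha>"
  using coarser_mobius[of v w \<alpha>, OF assms]
  by (simp add: ribbon_def linear_form_sum[OF linear_extend_form])

lemma extend_form_linear_value:
  assumes "\<And>\<alpha>. Vector_Spaces.linear (*\<^sub>K) (*) (\<lambda>y. v y \<alpha>)"
  shows "Vector_Spaces.linear (*\<^sub>K) (*) (\<lambda>y. extend_form (v y) x)"
proof -
  have "v (y + z) \<alpha> = v y \<alpha> + v z \<alpha>" "v (c *\<^sub>K y) \<alpha> = c * v y \<alpha>" for c y z \<alpha>
    using assms[of \<alpha>] by (simp_all add: Vector_Spaces.linear_iff)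
  then show ?thesis
    by (simp add: Vector_Spaces.linear_iff vector_space_scale vector_space_mult extend_form_def
        sum.distrib sum_distrib_left algebra_simps)
qed

lemma ex1_scalar_product:
  "\<exists>!B. bilinear_form B \<and> (\<forall>\<alpha> \<beta>. B (ribbon \<alpha>) (ribbon \<beta>) = ribbon_form \<alpha> \<beta>)"
proof (rule ex_ex1I)
  define r where "r \<alpha> = extend_form (\<lambda>\<beta>. \<Sum>\<delta> | \<beta> \<preceq> \<delta>. ribbon_form \<alpha> \<delta>)" for \<alpha>
  define B where "B x y = extend_form (\<lambda>\<alpha>. \<Sum>\<gamma> | \<alpha> \<preceq> \<gamma>. r \<gamma> y) x" for x y
  have r: "Vector_Spaces.linear (*\<^sub>K) (*) (r \<alpha>)" for \<alpha>
    unfolding r_def by (rule linear_extend_form)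
  have "Vector_Spaces.linear (*\<^sub>K) (*) (\<lambda>y. \<Sum>\<gamma> | \<alpha> \<preceq> \<gamma>. r \<gamma> y)" for \<alpha>
  proof -
    have "r \<gamma> (y + z) = r \<gamma> y + r \<gamma> z" "r \<gamma> (c *\<^sub>K y) = c * r \<gamma> y" for c y z \<gamma>
      using r[of \<gamma>] by (simp_all add: Vector_Spaces.linear_iff)
    then show ?thesis
      by (simp add: Vector_Spaces.linear_iff vector_space_scale vector_space_mult sum.distrib sum_distrib_left)
  qed
  then have "bilinear_form B"
    unfolding bilinear_form_def B_def
    by (intro conjI allI linear_extend_form extend_form_linear_value)
  moreover have "B (ribbon \<alpha>) (ribbon \<beta>) = ribbon_form \<alpha> \<beta>" for \<alpha> \<beta>
  proof -
    have "B (ribbon \<alpha>) (ribbon \<beta>) = r \<alpha> (ribbon \<beta>)"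
      unfolding B_def by (rule extend_form_ribbon) simp
    also have "\<dots> = ribbon_form \<alpha> \<beta>"
      unfolding r_def by (rule extend_form_ribbon) simp
    finally show ?thesis .
  qed
  ultimately show "\<exists>B. bilinear_form B \<and> (\<forall>\<alpha> \<beta>. B (ribbon \<alpha>) (ribbon \<beta>) = ribbon_form \<alpha> \<beta>)"
    by (intro exI[of _ B] conjI allI)
next
  fix B C
  assume "bilinear_form B \<and> (\<forall>\<alpha> \<beta>. B (ribbon \<alpha>) (ribbon \<beta>) = ribbon_form \<alpha> \<beta>)"
    and "bilinear_form C \<and> (\<forall>\<alpha> \<beta>. C (ribbon \<alpha>) (ribbon \<beta>) = ribbon_form \<alpha> \<beta>)"
  then have lin: "Vector_Spaces.linear (*\<^sub>K) (*) (\<lambda>y. B x y)"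
      "Vector_Spaces.linear (*\<^sub>K) (*) (\<lambda>x. B x y)"
      "Vector_Spaces.linear (*\<^sub>K) (*) (\<lambda>y. C x y)"
      "Vector_Spaces.linear (*\<^sub>K) (*) (\<lambda>x. C x y)"
    and eq: "B (ribbon \<alpha>) (ribbon \<beta>) = C (ribbon \<alpha>) (ribbon \<beta>)" for x y \<alpha> \<beta>
    by (simp_all add: bilinear_form_def)
  have "B (ribbon \<alpha>) y = C (ribbon \<alpha>) y" for \<alpha> y
    by (rule linear_form_ext[OF lin(1) lin(3) eq])
  then have "B x y = C x y" for x y
    by (rule linear_form_ext[OF lin(2) lin(4)])
  then show "B = C" by (intro ext)
qed

lemma bilinear_scalar_product: "bilinear_form scalar_product"
  unfolding scalar_product_def by (rule theI'[OF ex1_scalar_product, THEN conjunct1])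

lemma scalar_product_ribbon: "scalar_product (ribbon \<alpha>) (ribbon \<beta>) = ribbon_form \<alpha> \<beta>"
  unfolding scalar_product_def
  by (rule theI'[OF ex1_scalar_product, THEN conjunct2, rule_format])

end

theory Submission
  imports Defs
begin

text \<open>With \<open>A\<close>, \<open>C\<close>, \<open>S\<close> the descent sets of \<open>\<alpha>\<close>, \<open>\<beta>\<close>, \<open>\<gamma>\<close>, the pairing is, up to the sign
  \<open>(-1)\<^sup>n\<^sup>+\<^sup>1\<close>, the sum over all \<open>S \<subseteq> {1..<n}\<close> of a weight that is multiplicative over the positions
  \<open>i\<close>. Hence it is a product over \<open>i\<close> of two-term sums. Such a factor vanishes when \<open>i\<close> lies in both or
  in neither of \<open>A\<close> and \<open>C\<close>, and otherwise it is \<open>\<plusminus>(1 - q\<^sup>n\<^sup>-\<^sup>i t\<^sup>i)\<close>, with the minus sign for \<open>i \<in> A\<close>.\<close>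

lemma weight_rev_comp [simp]: "weight (rev_comp \<gamma>) = weight \<gamma>"
  by (simp add: weight_def rev_comp.rep_eq)

text \<open>A prefix of the reversed list is a suffix of \<open>xs\<close> read backwards, so its
  sum is the total minus the sum of the complementary prefix. The map \<open>i\<close> to
  \<open>length xs - i\<close> permutes the lengths of the proper nonempty prefixes.\<close>

lemma partial_sums_rev: "partial_sums (rev xs) = (\<lambda>s. sum_list xs - s) ` partial_sums xs"
proof -
  have take_rev': "sum_list (take i (rev xs)) = sum_list xs - sum_list (take (length xs - i) xs)" for i
  proof -
    have "sum_list xs = sum_list (take (length xs - i) xs) + sum_list (drop (length xs - i) xs)"
      by (simp flip: sum_list_append)
    then show ?thesis by (simp add: take_rev)
  qed
  have "{1..<length xs} = (\<lambda>i. length xs - i) ` {1..<length xs}" (is "?I = _")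
  proof
    show "?I \<subseteq> (\<lambda>i. length xs - i) ` ?I"
      by (rule subsetI, rule_tac x = "length xs - x" in image_eqI) auto
  qed auto
  then have "(\<lambda>i. f (length xs - i)) ` ?I = f ` ?I" for f :: "nat \<Rightarrow> nat"
    by (metis image_image)
  from this[of "\<lambda>i. sum_list xs - sum_list (take i xs)"] show ?thesis
    by (simp add: partial_sums_def image_image take_rev')
qed

lemma descents_rev_comp: "descents (rev_comp \<gamma>) = (\<lambda>i. weight \<gamma> - i) ` descents \<gamma>"
  by (simp add: descents_def weight_def rev_comp.rep_eq partial_sums_rev)

lemma descents_subset: "descents \<gamma> \<subseteq> {1..<weight \<gamma>}"
  using bij_betw_apply[OF bij_descents, of \<gamma> "weight \<gamma>"] by auto

lemma composition_eqI:
  assumes "weight \<alpha> = weight \<beta>" "descents \<alpha> = descents \<beta>"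
  shows "\<alpha> = \<beta>"
  using assms bij_betw_imp_inj_on[OF bij_descents[of "weight \<beta>"]] by (auto dest: inj_onD)

lemma compl_comp_compl_comp [simp]: "compl_comp (compl_comp \<alpha>) = \<alpha>"
  by (rule composition_eqI) (use descents_subset[of \<alpha>] in \<open>auto simp: compl_comp\<close>)

text \<open>Positive weight excludes the empty composition, whose length and number of descents are
  both 0. The equation splits the sign in \<open>ribbon_form\<close> into a constant and a sign
  depending only on the descent set.\<close>

lemma len_eq_card_descents:
  assumes "0 < weight \<gamma>"
  shows "len \<gamma> = Suc (card (descents \<gamma>))"
proof -
  have "0 < len \<gamma>"
    using assms by (auto simp: len_def weight_def)
  then show ?thesis
    using partial_sums_card[of "parts \<gamma>"] parts[of \<gamma>] by (simp add: descents_def len_def)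
qed

lemma c_stat_compl_comp:
  "weight \<alpha> = weight \<gamma> \<Longrightarrow> c_stat \<alpha> (compl_comp \<gamma>) = \<Sum>(descents \<alpha> - descents \<gamma>)"
  using descents_subset[of \<alpha>] unfolding c_stat_def compl_comp
  by (intro arg_cong[where f = "\<Sum>"]) auto

text \<open>Both arguments are reversals, so their descent sets are images under the reflection
  \<open>i\<close> to \<open>weight \<gamma> - i\<close>. It is injective on the interval, so one
  may intersect first and reflect afterwards.\<close>

lemma c_stat_conj_rev_comp:
  assumes "weight \<alpha> = weight \<gamma>"
  shows "c_stat (conj_comp \<alpha>) (rev_comp \<gamma>) = (\<Sum>i\<in>descents \<gamma> - descents \<alpha>. weight \<gamma> - i)"
proof -
  have inj: "inj_on (\<lambda>i. weight \<gamma> - i) {1..<weight \<gamma>}"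
    by (auto simp: inj_on_def)
  have "descents (conj_comp \<alpha>) \<inter> descents (rev_comp \<gamma>)
      = (\<lambda>i. weight \<gamma> - i) ` (({1..<weight \<gamma>} - descents \<alpha>) \<inter> descents \<gamma>)"
    unfolding conj_comp_def descents_rev_comp compl_comp assms
    by (rule inj_on_image_Int[OF inj, symmetric]) (use descents_subset[of \<gamma>] in auto)
  also have "({1..<weight \<gamma>} - descents \<alpha>) \<inter> descents \<gamma> = descents \<gamma> - descents \<alpha>"
    using descents_subset[of \<gamma>] by auto
  finally show ?thesis
    unfolding c_stat_def using descents_subset[of \<gamma>]
    by (simp only:) (subst sum.reindex, rule inj_on_subset[OF inj], auto)
qed

lemma scalar_product_sum:
  "scalar_product (\<Sum>\<gamma>\<in>A. a \<gamma> *\<^sub>K ribbon \<gamma>) (\<Sum>\<delta>\<in>B. b \<delta> *\<^sub>K ribbon \<delta>)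
    = (\<Sum>\<gamma>\<in>A. \<Sum>\<delta>\<in>B. a \<gamma> * b \<delta> * ribbon_form \<gamma> \<delta>)"
proof -
  have lin: "Vector_Spaces.linear (*\<^sub>K) (*) (\<lambda>y. scalar_product x y)"
    "Vector_Spaces.linear (*\<^sub>K) (*) (\<lambda>x. scalar_product x y)" for x y
    using bilinear_scalar_product by (simp_all add: bilinear_form_def)
  show ?thesis
    unfolding linear_form_sum[OF lin(2), where g = ribbon]
    by (simp only: linear_form_sum[OF lin(1)] scalar_product_ribbon sum_distrib_left mult.assoc)
qed

text \<open>\<open>S\<close> stands for the descent set of a ribbon in the left argument and
  \<open>{1..<n} - S\<close> for that of its complement, the only ribbon that it pairs with
  nontrivially. The sum is the expansion of a product of differences, with \<open>S\<close>
  recording where the subtracted term is chosen.\<close>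

lemma sum_Pow_interval:
  fixes q t :: "'a::comm_ring_1"
  assumes "A \<subseteq> {1..<n}" "C \<subseteq> {1..<n}"
  shows "(\<Sum>S\<in>Pow {1..<n}. (-1) ^ card S *
      (t ^ \<Sum>(A - S) * q ^ (\<Sum>i\<in>S - A. n - i)) *
      (t ^ \<Sum>(C \<inter> S) * q ^ (\<Sum>i\<in>({1..<n} - S) - C. n - i))) =
    (if A = {1..<n} - C then (-1) ^ card A * (\<Prod>i\<in>{1..<n}. 1 - q ^ (n - i) * t ^ i) else 0)"
    (is "(\<Sum>S\<in>Pow ?N. ?term S) = _")
proof -
  \<comment> \<open>\<open>f i\<close> collects what position \<open>i\<close> contributes when it
    lies outside \<open>S\<close>, and \<open>g i\<close> what it contributes when it lies in
    \<open>S\<close>.\<close>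
  define f where "f = (\<lambda>i. (if i \<in> A then t ^ i else 1) * (if i \<in> - C then q ^ (n - i) else 1))"
  define g where "g = (\<lambda>i. (if i \<in> - A then q ^ (n - i) else 1) * (if i \<in> C then t ^ i else 1))"
  have "(\<Sum>S\<in>Pow ?N. ?term S) = (\<Sum>S\<in>Pow ?N. (-1) ^ card S * prod g S * prod f (?N - S))"
  proof (rule sum.cong[OF refl])
    fix S assume "S \<in> Pow ?N"
    then have fin: "finite S" and
      sets: "A - S = (?N - S) \<inter> A" "S - A = S \<inter> - A" "C \<inter> S = S \<inter> C" "?N - S - C = (?N - S) \<inter> - C"
      using assms finite_subset[of S ?N] by auto
    \<comment> \<open>The intersections in \<open>sets\<close> have the shape that
      \<open>prod.inter_restrict\<close> needs: a power whose exponent is a sum over a restricted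
      set becomes a product with default factor 1.\<close>
    have "prod f (?N - S) = t ^ \<Sum>(A - S) * q ^ (\<Sum>i\<in>?N - S - C. n - i)"
      unfolding sets(1,4) power_sum f_def prod.distrib
      by (simp only: prod.inter_restrict finite_Diff finite_atLeastLessThan)
    moreover have "prod g S = q ^ (\<Sum>i\<in>S - A. n - i) * t ^ \<Sum>(C \<inter> S)"
      unfolding sets(2) sets(3) power_sum g_def prod.distrib
      by (simp only: prod.inter_restrict fin)
    ultimately show "?term S = (-1) ^ card S * prod g S * prod f (?N - S)"
      by (simp only: mult_ac)
  qed
  also have "\<dots> = (\<Prod>i\<in>?N. f i - g i)"
    by (rule prod_diff_conv_sum[symmetric]) simp
  also have "\<dots> = (if A = ?N - C then (-1) ^ card A * (\<Prod>i\<in>?N. 1 - q ^ (n - i) * t ^ i) else 0)"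
  proof (cases "A = ?N - C")
    case True
    have "(\<Prod>i\<in>?N. f i - g i) = (\<Prod>i\<in>?N. (if i \<in> A then -1 else 1) * (1 - q ^ (n - i) * t ^ i))"
      using True by (intro prod.cong) (auto simp: f_def g_def algebra_simps)
    also have "\<dots> = (\<Prod>i\<in>?N \<inter> A. -1) * (\<Prod>i\<in>?N. 1 - q ^ (n - i) * t ^ i)"
      by (simp only: prod.distrib prod.inter_restrict finite_atLeastLessThan)
    finally show ?thesis
      using True by (simp add: Int_absorb1 Diff_subset)
  next
    case False
    then obtain i where "i \<in> ?N" "i \<in> A \<longleftrightarrow> i \<in> C"
      using assms by blast
    \<comment> \<open>Here \<open>f i\<close> and \<open>g i\<close> agree: both are
      \<open>t ^ i\<close> if \<open>i\<close> lies in both sets, and both are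
      \<open>q ^ (n - i)\<close> if it lies in neither.\<close>
    then have "\<exists>i\<in>?N. f i - g i = 0"
      by (intro bexI[of _ i]) (auto simp: f_def g_def)
    then have "(\<Prod>i\<in>?N. f i - g i) = 0"
      by (intro prod_zero) simp_all
    with False show ?thesis
      by simp
  qed
  finally show ?thesis .
qed

text \<open>Complementation is an involution. With the condition solved for the second argument, the
  inner sum of the pairing collapses to one term.\<close>

lemma ribbon_form_eq:
  "ribbon_form \<gamma> \<delta> = (if \<delta> = compl_comp \<gamma> then (-1) ^ (weight \<gamma> + len \<gamma>) else 0)"
proof -
  have "\<gamma> = compl_comp \<delta> \<longleftrightarrow> \<delta> = compl_comp \<gamma>"
    by auto
  then show ?thesis
    by (simp add: ribbon_form_def)
qed

theorem proposition17:
  fixes \<alpha> \<beta> :: composition and n m :: nat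
  assumes "\<alpha> \<Turnstile> n" and "\<beta> \<Turnstile> m"
  shows "scalar_product (H_qt \<alpha>) (H_qt \<beta>) =
    (-1) ^ (weight \<alpha> + len \<alpha>) * (if \<alpha> = compl_comp \<beta> then 1 else 0) *
      (\<Prod>i = 1..n - 1. 1 - q_var ^ i * t_var ^ (n - i))"
proof -
  have n: "0 < n" "weight \<alpha> = n" and m: "weight \<beta> = m"
    using assms by (simp_all add: composition_of_def)
  define a where "a \<epsilon> \<gamma> = t_var ^ c_stat \<epsilon> (compl_comp \<gamma>) * q_var ^ c_stat (conj_comp \<epsilon>) (rev_comp \<gamma>)"
    for \<epsilon> \<gamma>
  have pairing: "scalar_product (H_qt \<alpha>) (H_qt \<beta>) = (\<Sum>\<gamma> | weight \<gamma> = n. \<Sum>\<delta> | weight \<delta> = m.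
      a \<alpha> \<gamma> * a \<beta> \<delta> * ribbon_form \<gamma> \<delta>)"
    unfolding H_qt_def n m a_def by (rule scalar_product_sum)
  show ?thesis
  proof (cases "m = n")
    case False
    \<comment> \<open>Complementation preserves weight, so no ribbon of weight \<open>n\<close> is
      complementary to one of weight \<open>m\<close>.\<close>
    then have "scalar_product (H_qt \<alpha>) (H_qt \<beta>) = 0"
      unfolding pairing by (intro sum.neutral ballI) (auto simp: ribbon_form_eq compl_comp)
    moreover have "\<alpha> \<noteq> compl_comp \<beta>"
      using False n m by (auto simp: compl_comp)
    ultimately show ?thesis by simp
  next
    case True
    let ?A = "descents \<alpha>" and ?C = "descents \<beta>" and ?N = "{1..<n}"
    define term' where "term' S = (-1) ^ card S * (t_var ^ \<Sum>(?A - S) * q_var ^ (\<Sum>i\<in>S - ?A. n - i)) *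
      (t_var ^ \<Sum>(?C \<inter> S) * q_var ^ (\<Sum>i\<in>(?N - S) - ?C. n - i))" for S
    have sub: "?A \<subseteq> ?N" "?C \<subseteq> ?N"
      using descents_subset[of \<alpha>] descents_subset[of \<beta>] n m True by simp_all
    have "scalar_product (H_qt \<alpha>) (H_qt \<beta>) = (\<Sum>\<gamma> | weight \<gamma> = n. (-1) ^ Suc n * term' (descents \<gamma>))"
      unfolding pairing
    proof (rule sum.cong[OF refl])
      fix \<gamma> assume "\<gamma> \<in> {\<gamma>. weight \<gamma> = n}"
      then have w: "weight \<gamma> = n" by simp
      have "(\<Sum>\<delta> | weight \<delta> = m. a \<alpha> \<gamma> * a \<beta> \<delta> * ribbon_form \<gamma> \<delta>) =
          (\<Sum>\<delta> | weight \<delta> = m. if \<delta> = compl_comp \<gamma>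
            then a \<alpha> \<gamma> * a \<beta> (compl_comp \<gamma>) * (-1) ^ (weight \<gamma> + len \<gamma>) else 0)"
        by (rule sum.cong) (simp_all add: ribbon_form_eq)
      also have "\<dots> = a \<alpha> \<gamma> * a \<beta> (compl_comp \<gamma>) * (-1) ^ (weight \<gamma> + len \<gamma>)"
        using w True by (simp add: compl_comp)
      finally have sum_delta: "(\<Sum>\<delta> | weight \<delta> = m. a \<alpha> \<gamma> * a \<beta> \<delta> * ribbon_form \<gamma> \<delta>) =
          a \<alpha> \<gamma> * a \<beta> (compl_comp \<gamma>) * (-1) ^ (weight \<gamma> + len \<gamma>)" .
      have sign: "(-1) ^ (weight \<gamma> + len \<gamma>) = (-1 :: qt_field) ^ Suc n * (-1) ^ card (descents \<gamma>)"
        using w n by (simp add: len_eq_card_descents power_add)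
      have coeff_\<alpha>: "a \<alpha> \<gamma> = t_var ^ \<Sum>(?A - descents \<gamma>) * q_var ^ (\<Sum>i\<in>descents \<gamma> - ?A. n - i)"
        using w n by (simp add: a_def c_stat_compl_comp c_stat_conj_rev_comp)
      \<comment> \<open>The two complements cancel in the exponent of \<open>t\<close>, which leaves
        the intersection with the descents of \<open>\<gamma>\<close>; in the exponent of
        \<open>q\<close> the descents of \<open>\<gamma>\<close> are replaced by their
        complement.\<close>
      have coeff_\<beta>: "a \<beta> (compl_comp \<gamma>) =
          t_var ^ \<Sum>(?C \<inter> descents \<gamma>) * q_var ^ (\<Sum>i\<in>(?N - descents \<gamma>) - ?C. n - i)"
        using w m True by (simp add: a_def c_stat_conj_rev_comp compl_comp) (simp add: c_stat_def)
      show "(\<Sum>\<delta> | weight \<delta> = m. a \<alpha> \<gamma> * a \<beta> \<delta> * ribbon_form \<gamma> \<delta>) =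
          (-1) ^ Suc n * term' (descents \<gamma>)"
        unfolding sum_delta unfolding sign coeff_\<alpha> coeff_\<beta> term'_def
        by (simp only: mult_ac)
    qed
    also have "\<dots> = (\<Sum>S\<in>Pow ?N. (-1) ^ Suc n * term' S)"
      by (rule sum.reindex_bij_betw[OF bij_descents])
    also have "\<dots> = (-1) ^ Suc n *
        (if ?A = ?N - ?C then (-1) ^ card ?A * (\<Prod>i\<in>?N. 1 - q_var ^ (n - i) * t_var ^ i) else 0)"
      unfolding sum_distrib_left[symmetric] term'_def sum_Pow_interval[OF sub] ..
    also have "?A = ?N - ?C \<longleftrightarrow> \<alpha> = compl_comp \<beta>"
    proof
      show "?A = ?N - ?C" if "\<alpha> = compl_comp \<beta>"
        unfolding that using m True by (simp add: compl_comp)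
      show "\<alpha> = compl_comp \<beta>" if "?A = ?N - ?C"
        using that n m True by (intro composition_eqI) (simp_all add: compl_comp)
    qed
    \<comment> \<open>Reflecting the index by \<open>i\<close> to \<open>n - i\<close> exchanges the
      two exponents.\<close>
    also have "(\<Prod>i\<in>?N. 1 - q_var ^ (n - i) * t_var ^ i) =
        (\<Prod>i = 1..n - 1. 1 - q_var ^ i * t_var ^ (n - i))"
      by (rule prod.reindex_bij_witness[of _ "\<lambda>i. n - i" "\<lambda>i. n - i"]) auto
    finally show ?thesis
      using n by (simp add: len_eq_card_descents power_add)
  qed
qed

end
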